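(* The ERI space $(X_0,\tau_{\mathrm{ERI}})$ is a US-space: every convergent sequence in it has a unique limit. In particular, the ERI space is not Fréchet–Urysohn.
   Context: Let $\overline{\mathbb{R}}=[-\infty,+\infty]$ be the extended real line with its order topology. Let $\sim$ be the equivalence relation on $\overline{\mathbb{R}}$ whose only non-singleton class is $\{-\infty,0,+\infty\}$, let $X_0=\overline{\mathbb{R}}/{\sim}$ be the quotient set, $q\colon\overline{\mathbb{R}}\to X_0$ the projection, and $\ast=q(-\infty)=q(0)=q(+\infty)$. The ERI topology $\tau_{\mathrm{ERI}}$ on $X_0$ consists of all $U\subseteq X_0$ such that (a) $q^{-1}(U)$ is open in $\overline{\mathbb{R}}$, and (b) if $\ast\in U$ then $q^{-1}(U)$ is dense in $\overline{\mathbb{R}}$. (This is a topology.) The ERI space is $X=(X_0,\tau_{\mathrm{ERI}})$. A space is Fréchet–Urysohn if every point in the closure of a set $S$ is the limit of a sequence of points of $S$. *)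

theory Defs
  imports "HOL-Analysis.Analysis"
begin

definition eri_rel :: "(ereal \<times> ereal) set" where
  "eri_rel = {(x, y). x = y \<or> (x \<in> {-\<infinity>, 0, \<infinity>} \<and> y \<in> {-\<infinity>, 0, \<infinity>})}"

definition eri_carrier :: "ereal set set" where
  "eri_carrier = UNIV // eri_rel"

definition eri_proj :: "ereal \<Rightarrow> ereal set" where
  "eri_proj x = eri_rel `` {x}"

definition eri_star :: "ereal set" where
  "eri_star = eri_proj 0"

(* The second conjunct alone gives the quotient topology; the third makes every
   neighbourhood of the special point dense in the extended reals. *)
definition eri_open :: "ereal set set \<Rightarrow> bool" where
  "eri_open U \<longleftrightarrow> U \<subseteq> eri_carrier \<and> open (eri_proj -` U) \<and>
     (eri_star \<in> U \<longrightarrow> closure (eri_proj -` U) = UNIV)"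

definition eri_space :: "ereal set topology" where
  "eri_space = topology eri_open"

(* The space is not assumed to be Hausdorff, so limitin is a genuine relation
   between sequences and points. *)
definition US_space :: "'a topology \<Rightarrow> bool" where
  "US_space X \<longleftrightarrow> (\<forall>\<sigma> l m. range \<sigma> \<subseteq> topspace X \<longrightarrow>
     limitin X \<sigma> l sequentially \<longrightarrow> limitin X \<sigma> m sequentially \<longrightarrow> l = m)"

definition Frechet_Urysohn_space :: "'a topology \<Rightarrow> bool" where
  "Frechet_Urysohn_space X \<longleftrightarrow> (\<forall>S x. S \<subseteq> topspace X \<longrightarrow> x \<in> X closure_of S \<longrightarrow>
     (\<exists>\<sigma>. range \<sigma> \<subseteq> S \<and> limitin X \<sigma> x sequentially))"

lemma equiv_eri_rel: "equiv UNIV eri_rel"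
  by (rule equivI) (auto simp: eri_rel_def refl_on_def sym_def trans_def)

lemma eri_proj_in_carrier: "eri_proj x \<in> eri_carrier"
  by (simp add: eri_proj_def eri_carrier_def quotientI)

lemma eri_proj_eq_iff: "eri_proj x = eri_proj y \<longleftrightarrow> (x, y) \<in> eri_rel"
  using equiv_eri_rel by (simp add: eri_proj_def eq_equiv_class_iff)

lemma eri_proj_eq_star: "eri_proj (-\<infinity>) = eri_star" "eri_proj 0 = eri_star" "eri_proj \<infinity> = eri_star"
  by (simp_all add: eri_star_def eri_proj_eq_iff) (simp_all add: eri_rel_def)

lemma eri_open_Int:
  assumes "eri_open U" "eri_open V"
  shows "eri_open (U \<inter> V)"
proof -
  have "closure (eri_proj -` (U \<inter> V)) = UNIV" if "eri_star \<in> U \<inter> V"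
  proof -
    have "open (eri_proj -` U)" and "closure (eri_proj -` U) = UNIV"
      and "closure (eri_proj -` V) = UNIV"
      using assms that by (auto simp: eri_open_def)
    then show ?thesis
      using open_Int_closure_subset[of "eri_proj -` U" "eri_proj -` V"]
      by (metis Int_UNIV_right closure_closure closure_mono top.extremum_uniqueI vimage_Int)
  qed
  then show ?thesis
    using assms by (auto simp: eri_open_def)
qed

lemma eri_open_Union:
  assumes "\<And>U. U \<in> \<U> \<Longrightarrow> eri_open U"
  shows "eri_open (\<Union>\<U>)"
proof -
  have "closure (eri_proj -` \<Union>\<U>) = UNIV" if "U \<in> \<U>" "eri_star \<in> U" for U
  proof -
    have "closure (eri_proj -` U) \<subseteq> closure (eri_proj -` \<Union>\<U>)"
      using that by (intro closure_mono) auto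
    then show ?thesis
      using assms[OF that(1)] that(2) by (auto simp: eri_open_def)
  qed
  moreover have "open (eri_proj -` \<Union>\<U>)"
    using assms unfolding vimage_Union by (intro open_UN) (auto simp: eri_open_def)
  moreover have "\<Union>\<U> \<subseteq> eri_carrier"
    using assms by (meson Union_least eri_open_def)
  ultimately show ?thesis
    by (auto simp: eri_open_def)
qed

lemma openin_eri_space: "openin eri_space = eri_open"
  unfolding eri_space_def
  by (rule topology_inverse') (auto simp: istopology_def intro: eri_open_Int eri_open_Union)

lemma topspace_eri_space: "topspace eri_space = eri_carrier"
proof -
  have "eri_proj -` eri_carrier = UNIV"
    using eri_proj_in_carrier by auto
  then have "openin eri_space eri_carrier"
    by (simp add: openin_eri_space eri_open_def)
  moreover have "topspace eri_space \<subseteq> eri_carrier"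
    by (auto simp: topspace_def openin_eri_space eri_open_def)
  ultimately show ?thesis
    using openin_subset by blast
qed

end

theory Submission
  imports Defs
begin

text \<open>
  Away from the special point, convergence in the ERI space is convergence of representatives in
  the extended reals, where limits are unique. A sequence of non-special points that converges to
  a non-special point \<open>x\<close> cannot converge to the special point as well: together with \<open>x\<close> it
  forms a countable compact set, whose complement is open and dense and hence a neighbourhood of
  the special point. Finally, the special point lies in the closure of the image of \<open>[1, 2]\<close>, but
  by compactness any sequence from this image clusters at a non-special point, so it cannot converge
  to the special point.
\<close>

definition eri_special :: "ereal set" where
  "eri_special = {-\<infinity>, 0, \<infinity>}"

lemma eri_proj_eq_iff_special:
  "eri_proj x = eri_proj y \<longleftrightarrow> x = y \<or> x \<in> eri_special \<and> y \<in> eri_special"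
  by (simp add: eri_proj_eq_iff eri_rel_def eri_special_def)

lemma eri_proj_eq_star_iff: "eri_proj x = eri_star \<longleftrightarrow> x \<in> eri_special"
  unfolding eri_star_def eri_proj_eq_iff_special by (auto simp: eri_special_def)

lemma range_eri_proj: "range eri_proj = eri_carrier"
  by (auto simp: eri_carrier_def eri_proj_def quotient_def)

lemma closed_eri_special: "closed eri_special"
  by (simp add: eri_special_def)

text \<open>The hypothesis makes \<open>W\<close> saturated: the only class with more than one
  element lies entirely outside or entirely inside \<open>W\<close>.\<close>

lemma vimage_image_eri_proj:
  assumes "eri_special \<inter> W = {} \<or> eri_special \<subseteq> W"
  shows "eri_proj -` (eri_proj ` W) = W"
proof (intro equalityI subsetI)
  fix x
  assume "x \<in> eri_proj -` (eri_proj ` W)"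
  then obtain w where "w \<in> W" "eri_proj x = eri_proj w"
    by blast
  then show "x \<in> W"
    using assms unfolding eri_proj_eq_iff_special by blast
qed blast

text \<open>The image misses \<open>eri_star\<close>, so the density condition is vacuous and only
  openness of the preimage matters.\<close>

lemma eri_open_image_nonspecial:
  assumes "open W" "eri_special \<inter> W = {}"
  shows "eri_open (eri_proj ` W)"
proof -
  have "eri_star \<notin> eri_proj ` W"
    using assms(2) by (metis IntI emptyE eri_proj_eq_star_iff imageE)
  then show ?thesis
    using assms by (auto simp: eri_open_def vimage_image_eri_proj eri_proj_in_carrier)
qed

lemma eri_open_image_dense:
  assumes "open W" "eri_special \<subseteq> W" "closure W = UNIV"
  shows "eri_open (eri_proj ` W)"
  using assms by (auto simp: eri_open_def vimage_image_eri_proj eri_proj_in_carrier)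

text \<open>A nonempty open set of extended reals contains a nondegenerate real interval, which is
  uncountable. This makes complements of countable sets dense.\<close>

lemma interior_countable_ereal:
  fixes K :: "ereal set"
  assumes "countable K"
  shows "interior K = {}"
proof (rule ccontr)
  assume "interior K \<noteq> {}"
  then obtain p where p: "p \<in> interior K"
    by blast
  \<comment> \<open>The point \<open>q\<close> shows on which side of \<open>p\<close> there is
    room; this also covers an infinite \<open>p\<close>, where only one side exists.\<close>
  obtain q where q: "q \<in> interior K" "q \<noteq> p"
    using p not_open_singleton[of p] by (metis empty_iff insertI1 open_interior subsetI subset_singletonD)
  have mid: False if "a < b" "{a..<b} \<subseteq> interior K \<or> {a<..b} \<subseteq> interior K" for a b
  proof -
    obtain r where r: "a < ereal r" "ereal r < b"
      using ereal_dense2 \<open>a < b\<close> by blast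
    obtain s where s: "ereal r < ereal s" "ereal s < b"
      using ereal_dense2[OF r(2)] by blast
    have "ereal ` {r<..<s} \<subseteq> {a<..<b}"
      using less_trans[OF r(1)] less_trans[OF _ s(2)] by force
    also have "{a<..<b} \<subseteq> {a..<b} \<inter> {a<..b}"
      by auto
    also have "\<dots> \<subseteq> K"
      using \<open>{a..<b} \<subseteq> interior K \<or> {a<..b} \<subseteq> interior K\<close> interior_subset[of K] by blast
    finally have "ereal ` {r<..<s} \<subseteq> K" .
    then have "countable (ereal ` {r<..<s})"
      using assms countable_subset by blast
    then have "countable {r<..<s}"
      by (rule countable_image_inj_on) (simp add: inj_on_def)
    then show False
      using s(1) uncountable_open_interval by auto
  qed
  show False
  proof (cases "p < q")
    case True
    then show False
      using open_right[OF open_interior p True] mid by blast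
  next
    case False
    then have "q < p"
      using q by auto
    then show False
      using open_left[OF open_interior p] mid by blast
  qed
qed

text \<open>Removing the closed set \<open>eri_special\<close> from a neighbourhood of
  \<open>x\<close> leaves a saturated open set that still contains \<open>x\<close>, and its image
  is a neighbourhood of \<open>eri_proj x\<close>.\<close>

lemma tendsto_of_limitin_eri_proj:
  assumes "limitin eri_space (\<lambda>n. eri_proj (y n)) (eri_proj x) F" "x \<notin> eri_special"
  shows "(y \<longlongrightarrow> x) F"
proof (rule topological_tendstoI)
  fix V :: "ereal set"
  assume V: "open V" "x \<in> V"
  define W where "W = V - eri_special"
  have W: "open W" "eri_special \<inter> W = {}" "x \<in> W"
    using V assms(2) closed_eri_special by (auto simp: W_def)
  have "\<forall>\<^sub>F n in F. eri_proj (y n) \<in> eri_proj ` W"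
    using assms(1) eri_open_image_nonspecial[OF W(1,2)] W(3)
    by (simp add: limitin_def openin_eri_space)
  then show "\<forall>\<^sub>F n in F. y n \<in> V"
  proof eventually_elim
    case (elim n)
    then have "y n \<in> W"
      using vimage_image_eri_proj[of W] W(2) by blast
    then show ?case
      by (simp add: W_def)
  qed
qed

lemma not_limitin_eri_star:
  assumes lim: "y \<longlonglongrightarrow> x" and x: "x \<notin> eri_special"
  shows "\<not> limitin eri_space (\<lambda>n. eri_proj (y n)) eri_star sequentially"
proof
  assume star: "limitin eri_space (\<lambda>n. eri_proj (y n)) eri_star sequentially"
  have "\<forall>\<^sub>F n in sequentially. y n \<in> - eri_special"
    using lim x closed_eri_special by (intro topological_tendstoD) auto
  then obtain N where N: "\<And>n. n \<ge> N \<Longrightarrow> y n \<notin> eri_special"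
    by (auto simp: eventually_sequentially)
  \<comment> \<open>The shift by \<open>N\<close> drops the terms that may be special, so that the
    complement of \<open>K\<close> contains the whole special class and is saturated.\<close>
  define K where "K = insert x (range (\<lambda>n. y (n + N)))"
  have "compact K"
    using compactin_sequence_with_limit[of euclidean "\<lambda>n. y (n + N)" x "range (\<lambda>n. y (n + N))"]
      LIMSEQ_ignore_initial_segment[OF lim]
    by (simp add: K_def)
  then have op: "open (- K)"
    by (simp add: compact_imp_closed open_Compl)
  have sp: "eri_special \<subseteq> - K"
    using N x by (auto simp: K_def)
  have "countable K"
    by (simp add: K_def)
  then have "closure (- K) = UNIV"
    by (simp add: closure_complement interior_countable_ereal)
  then have "eri_open (eri_proj ` (- K))"
    using op sp by (rule eri_open_image_dense[rotated 2])
  moreover have "eri_star \<in> eri_proj ` (- K)"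
    using sp by (auto simp: eri_star_def eri_special_def)
  ultimately have "\<forall>\<^sub>F n in sequentially. eri_proj (y n) \<in> eri_proj ` (- K)"
    using star by (simp add: limitin_def openin_eri_space)
  then obtain M where M: "\<And>n. n \<ge> M \<Longrightarrow> eri_proj (y n) \<in> eri_proj ` (- K)"
    by (auto simp: eventually_sequentially)
  \<comment> \<open>The index \<open>M + N\<close> is at least \<open>M\<close>, and the term there
    is also one of the shifted terms collected in \<open>K\<close>.\<close>
  have "y (M + N) \<in> - K"
    using M[of "M + N"] vimage_image_eri_proj[of "- K"] sp by auto
  then show False
    by (simp add: K_def)
qed

lemma US_space_eri_space: "US_space eri_space"
  unfolding US_space_def
proof (intro allI impI)
  fix \<sigma> l m
  assume \<sigma>: "range \<sigma> \<subseteq> topspace eri_space"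
    and l: "limitin eri_space \<sigma> l sequentially" and m: "limitin eri_space \<sigma> m sequentially"
  have "\<sigma> n \<in> range eri_proj" for n
    using \<sigma> by (auto simp: topspace_eri_space range_eri_proj)
  then have "\<forall>n. \<exists>t. \<sigma> n = eri_proj t"
    by (simp add: image_iff)
  then obtain y where y: "\<sigma> = (\<lambda>n. eri_proj (y n))"
    by metis
  obtain a where a: "l = eri_proj a"
    using limitin_topspace[OF l] by (auto simp: topspace_eri_space simp flip: range_eri_proj)
  obtain b where b: "m = eri_proj b"
    using limitin_topspace[OF m] by (auto simp: topspace_eri_space simp flip: range_eri_proj)
  have to_a: "y \<longlonglongrightarrow> a" if "a \<notin> eri_special"
    using tendsto_of_limitin_eri_proj l that y a by blast
  have to_b: "y \<longlonglongrightarrow> b" if "b \<notin> eri_special"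
    using tendsto_of_limitin_eri_proj m that y b by blast
  \<comment> \<open>Two special representatives name the same point, two non-special ones are limits
    of the same \<open>y\<close>, and the mixed cases are contradictory.\<close>
  consider "a \<in> eri_special" "b \<in> eri_special" | "a \<notin> eri_special" "b \<notin> eri_special"
    | "a \<in> eri_special" "b \<notin> eri_special" | "a \<notin> eri_special" "b \<in> eri_special"
    by blast
  then show "l = m"
  proof cases
    case 1
    then show ?thesis
      by (simp add: a b eri_proj_eq_iff_special)
  next
    case 2
    then show ?thesis
      using LIMSEQ_unique to_a to_b a b by blast
  next
    case 3
    then have "l = eri_star"
      by (simp add: a eri_proj_eq_star_iff)
    then show ?thesis
      using not_limitin_eri_star[OF to_b] 3 l y by simp
  next
    case 4
    then have "m = eri_star"
      by (simp add: b eri_proj_eq_star_iff)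
    then show ?thesis
      using not_limitin_eri_star[OF to_a] 4 m y by simp
  qed
qed

text \<open>Each neighbourhood of \<open>eri_star\<close> has a dense preimage, which therefore
  meets the nonempty open set \<open>W\<close>.\<close>

lemma eri_star_in_closure_of:
  assumes "open W" "W \<noteq> {}" "W \<subseteq> A"
  shows "eri_star \<in> eri_space closure_of (eri_proj ` A)"
  unfolding in_closure_of
proof (intro conjI allI impI)
  show "eri_star \<in> topspace eri_space"
    by (simp add: topspace_eri_space eri_star_def eri_proj_in_carrier)
  fix T
  assume "eri_star \<in> T \<and> openin eri_space T"
  then have "closure (eri_proj -` T) = UNIV"
    by (simp add: openin_eri_space eri_open_def)
  then have "W \<inter> eri_proj -` T \<noteq> {}"
    using assms(2) open_Int_closure_eq_empty[OF assms(1), of "eri_proj -` T"] by simp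
  then show "\<exists>y. y \<in> eri_proj ` A \<and> y \<in> T"
    using assms(3) by blast
qed

lemma not_Frechet_Urysohn_eri_space: "\<not> Frechet_Urysohn_space eri_space"
proof
  assume FU: "Frechet_Urysohn_space eri_space"
  \<comment> \<open>This interval has nonempty interior, which puts \<open>eri_star\<close> in the
    closure of its image; it is also compact and free of special points, so subsequential limits in
    it are non-special.\<close>
  define A where "A = {1..2::ereal}"
  have "{1<..<2::ereal} \<noteq> {}"
    using dense[of 1 "2::ereal"] by auto
  then have "eri_star \<in> eri_space closure_of (eri_proj ` A)"
    by (intro eri_star_in_closure_of[of "{1<..<2}"]) (auto simp: A_def)
  moreover have "eri_proj ` A \<subseteq> topspace eri_space"
    by (auto simp: topspace_eri_space eri_proj_in_carrier)
  ultimately obtain \<sigma> where \<sigma>: "range \<sigma> \<subseteq> eri_proj ` A"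
    "limitin eri_space \<sigma> eri_star sequentially"
    using FU unfolding Frechet_Urysohn_space_def by meson
  then have "\<forall>n. \<exists>t. t \<in> A \<and> \<sigma> n = eri_proj t"
    by (simp add: image_subset_iff image_iff Bex_def)
  then obtain y where y: "\<And>n. y n \<in> A" "\<sigma> = (\<lambda>n. eri_proj (y n))"
    by metis
  have "seq_compact A"
    unfolding A_def by (intro compact_imp_seq_compact) (simp add: compact_eq_closed)
  then obtain x r where xr: "x \<in> A" "strict_mono r" "(y \<circ> r) \<longlonglongrightarrow> x"
    using y(1) by (meson seq_compactE)
  have "x \<notin> eri_special"
    using xr(1) by (auto simp: A_def eri_special_def)
  then have "\<not> limitin eri_space (\<sigma> \<circ> r) eri_star sequentially"
    using not_limitin_eri_star[OF xr(3)] by (simp add: y(2) comp_def)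
  then show False
    using limitin_subsequence[OF xr(2) \<sigma>(2)] by blast
qed

theorem theorem3p18: "US_space eri_space \<and> \<not> Frechet_Urysohn_space eri_space"
  using US_space_eri_space not_Frechet_Urysohn_eri_space by blast

end
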